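(* There exists a dismantlable constraint graph $H$ such that: (1) $\mathrm{Hom}(\mathbb{Z}^2,H)$ does not satisfy topological strong spatial mixing (TSSM); (2) there is no nearest-neighbour interaction $\Phi$ for $H$ such that the Gibbs $(\mathbb{Z}^2,H,\Phi)$-specification satisfies strong spatial mixing; (3) for all $\gamma>0$ there exists a nearest-neighbour interaction $\Phi$ for $H$ such that the Gibbs $(\mathbb{Z}^2,H,\Phi)$-specification satisfies exponential weak spatial mixing with decay rate $\gamma$.
   Context: Graphs are undirected; $u\sim v$ denotes adjacency, $N(v)=\{u:u\sim v\}$ (so $v\in N(v)$ iff $v$ has a loop). A constraint graph is a finite graph $H=(V,E)$, loops allowed. $\mathbb{Z}^2$ denotes the simple graph with vertex set $\mathcal{V}=\mathbb{Z}^2$ and $x\sim y$ iff $\|x-y\|_1=1$. $\mathrm{Hom}(\mathbb{Z}^2,H)$ is the set of graph homomorphisms $\omega:\mathcal{V}\to V$ (points). $\mathrm{dist}$ is graph distance in $\mathbb{Z}^2$, $\mathrm{dist}(A,B)=\min_{x\in A,y\in B}\mathrm{dist}(x,y)$, $\mathrm{dist}(\cdot,\emptyset)=\infty$ (decay functions take the value $0$ at $\infty$), $\partial A=\{x:\mathrm{dist}(x,A)=1\}$, $\Sigma_B(\alpha_1,\alpha_2)=\{x\in B:\alpha_1(x)\ne\alpha_2(x)\}$. For $A\subseteq\mathcal{V}$, $\alpha\in V^A$ is globally admissible if $\alpha=\omega|_A$ for some point $\omega$. Concatenations such as $\alpha\beta$ denote the common extension of configurations on disjoint sets. $\mathbb{N}=\{0,1,2,\dots\}$.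 Dismantlable: if $u\neq v$ in $V$ satisfy $N(u)\subseteq N(v)$, a fold is the homomorphism from $H$ to the induced subgraph $H[V\setminus\{u\}]$ sending $u$ to $v$ and fixing all other vertices. $H$ is dismantlable if some (possibly empty) sequence of folds reduces $H$ to a graph with a single vertex (with or without a loop). TSSM: there is $g\in\mathbb{N}$ such that for all pairwise disjoint finite $A,B,S\subseteq\mathcal{V}$ with $\mathrm{dist}(A,B)\ge g$ and all $\alpha\in V^A,\beta\in V^B,\sigma\in V^S$, if $\alpha\sigma$ and $\sigma\beta$ are globally admissible then $\alpha\sigma\beta$ is globally admissible. Gibbs specification: a nearest-neighbour interaction for $H$ is a function $\Phi:V\cup E\to(-\infty,0]$; write $\Phi(u,v)=\Phi(\{u,v\})$. For finite $A\subseteq\mathcal{V}$, a point $\omega$ and $\alpha\in V^A$ such that $\alpha\,\omega|_{A^c}\in\mathrm{Hom}(\mathbb{Z}^2,H)$, let $$E^\Phi_{A,\omega}(\alpha)=\sum_{x\in A}\Big(\Phi(\alpha(x))+\tfrac12\sum_{y\in A:\,y\sim x}\Phi(\alpha(x),\alpha(y))+\sum_{y\in\partial A:\,y\sim x}\Phi(\alpha(x),\omega(y))\Big).$$ Let $\pi^\omega_A$ be the probability measure on $V^A$ with $\pi^\omega_A(\alpha)$ proportional to $e^{-E^\Phi_{A,\omega}(\alpha)}$ if $\alpha\,\omega|_{A^c}\in\mathrm{Hom}(\mathbb{Z}^2,H)$, and $0$ otherwise; $\pi^\omega_A(\beta)=\sum_{\alpha:\alpha|_B=\beta}\pi^\omega_A(\alpha)$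 for $\beta\in V^B$, $B\subseteq A$. The Gibbs $(\mathbb{Z}^2,H,\Phi)$-specification is $\pi=\{\pi^\omega_A\}$ over finite $A$ and points $\omega$. A decay function is $f:\mathbb{N}\to\mathbb{R}_{\ge0}$ with $f(n)\searrow0$ (nonincreasing, tending to $0$). $\pi$ satisfies strong spatial mixing (resp. weak spatial mixing) with rate $f$ if for all finite $A$, $B\subseteq A$, $\beta\in V^B$ and points $\omega_1,\omega_2$, $|\pi^{\omega_1}_A(\beta)-\pi^{\omega_2}_A(\beta)|\le|B|f(d)$ with $d=\mathrm{dist}(B,\Sigma_{\partial A}(\omega_1,\omega_2))$ (resp. $d=\mathrm{dist}(B,\partial A)$). $\pi$ satisfies strong spatial mixing if it does so with some decay function $f$. Exponential weak spatial mixing with decay rate $\gamma$ means weak spatial mixing with rate $f(n)=Ce^{-\gamma n}$ for some $C>0$. *)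

theory Defs
  imports "HOL-Analysis.Analysis"
begin

section \<open>Constraint graphs\<close>

text \<open>An edge is the unordered pair \<open>{u, v}\<close> of its endpoints; a loop at \<open>v\<close> is the singleton \<open>{v}\<close>.\<close>

record 'v cgraph =
  verts :: "'v set"
  edges :: "'v set set"

definition constraint_graph :: "'v cgraph \<Rightarrow> bool" where
  "constraint_graph H \<longleftrightarrow>
     finite (verts H) \<and> edges H \<subseteq> {{u, v} |u v. u \<in> verts H \<and> v \<in> verts H}"

definition nbhd :: "'v cgraph \<Rightarrow> 'v \<Rightarrow> 'v set" where
  "nbhd H v = {u \<in> verts H. {u, v} \<in> edges H}"

definition induced :: "'v cgraph \<Rightarrow> 'v set \<Rightarrow> 'v cgraph" where
  "induced H W = \<lparr>verts = W, edges = {e \<in> edges H. e \<subseteq> W}\<rparr>"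

definition folds_to :: "'v cgraph \<Rightarrow> 'v cgraph \<Rightarrow> bool" where
  "folds_to H H' \<longleftrightarrow>
     (\<exists>u\<in>verts H. \<exists>v\<in>verts H. u \<noteq> v \<and> nbhd H u \<subseteq> nbhd H v \<and> H' = induced H (verts H - {u}))"

definition dismantlable :: "'v cgraph \<Rightarrow> bool" where
  "dismantlable H \<longleftrightarrow> (\<exists>H' r. folds_to\<^sup>*\<^sup>* H H' \<and> verts H' = {r})"


section \<open>The square lattice\<close>

type_synonym site = "int \<times> int"

definition adj :: "site \<Rightarrow> site \<Rightarrow> bool" where
  "adj x y \<longleftrightarrow> \<bar>fst x - fst y\<bar> + \<bar>snd x - snd y\<bar> = 1"

text \<open>The length of a shortest path; it exists for all pairs of sites because the lattice is connected.\<close>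

definition site_dist :: "site \<Rightarrow> site \<Rightarrow> nat" where
  "site_dist x y = (LEAST n. (adj ^^ n) x y)"

text \<open>The infimum is attained for nonempty sets and equals \<open>\<infinity>\<close> if one of the sets is empty.\<close>

definition set_dist :: "site set \<Rightarrow> site set \<Rightarrow> enat" where
  "set_dist A B = (INF x\<in>A. INF y\<in>B. enat (site_dist x y))"

definition boundary :: "site set \<Rightarrow> site set" where
  "boundary A = {x. set_dist {x} A = 1}"


section \<open>Points and configurations\<close>

definition Hom :: "'v cgraph \<Rightarrow> (site \<Rightarrow> 'v) set" where
  "Hom H = {\<omega>. (\<forall>x. \<omega> x \<in> verts H) \<and> (\<forall>x y. adj x y \<longrightarrow> {\<omega> x, \<omega> y} \<in> edges H)}"

text \<open>
  Configurations on \<open>A\<close> are the elements of \<open>A \<rightarrow>\<^sub>E verts H\<close>, and configurations on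
  disjoint sets \<open>A\<close>, \<open>B\<close> are concatenated by \<^const>\<open>merge\<close>.
\<close>

definition globally_admissible :: "'v cgraph \<Rightarrow> site set \<Rightarrow> (site \<Rightarrow> 'v) \<Rightarrow> bool" where
  "globally_admissible H A \<alpha> \<longleftrightarrow> (\<exists>\<omega>\<in>Hom H. \<alpha> = restrict \<omega> A)"

definition disagreement :: "site set \<Rightarrow> (site \<Rightarrow> 'v) \<Rightarrow> (site \<Rightarrow> 'v) \<Rightarrow> site set" where
  "disagreement B \<alpha>\<^sub>1 \<alpha>\<^sub>2 = {x \<in> B. \<alpha>\<^sub>1 x \<noteq> \<alpha>\<^sub>2 x}"

definition TSSM :: "'v cgraph \<Rightarrow> bool" where
  "TSSM H \<longleftrightarrow> (\<exists>g::nat. \<forall>A B S. \<forall>\<alpha> \<in> A \<rightarrow>\<^sub>E verts H. \<forall>\<beta> \<in> B \<rightarrow>\<^sub>E verts H. \<forall>\<sigma> \<in> S \<rightarrow>\<^sub>E verts H.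
     finite A \<longrightarrow> finite B \<longrightarrow> finite S \<longrightarrow>
     A \<inter> B = {} \<longrightarrow> A \<inter> S = {} \<longrightarrow> B \<inter> S = {} \<longrightarrow> set_dist A B \<ge> enat g \<longrightarrow>
     globally_admissible H (A \<union> S) (merge A S (\<alpha>, \<sigma>)) \<longrightarrow>
     globally_admissible H (S \<union> B) (merge S B (\<sigma>, \<beta>)) \<longrightarrow>
     globally_admissible H (A \<union> S \<union> B) (merge (A \<union> S) B (merge A S (\<alpha>, \<sigma>), \<beta>)))"


section \<open>Gibbs specifications\<close>

text \<open>
  The domain of an interaction is the disjoint union of vertices and edges,
  so that a vertex \<open>v\<close> and the loop \<open>{v}\<close> carry separate values.
\<close>

type_synonym 'v interaction = "'v + 'v set \<Rightarrow> real"

definition nn_interaction :: "'v cgraph \<Rightarrow> 'v interaction \<Rightarrow> bool" where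
  "nn_interaction H \<Phi> \<longleftrightarrow> (\<forall>z \<in> verts H <+> edges H. \<Phi> z \<le> 0)"

definition energy :: "'v interaction \<Rightarrow> site set \<Rightarrow> (site \<Rightarrow> 'v) \<Rightarrow> (site \<Rightarrow> 'v) \<Rightarrow> real" where
  "energy \<Phi> A \<omega> \<alpha> = (\<Sum>x\<in>A. \<Phi> (Inl (\<alpha> x))
       + 1/2 * (\<Sum>y \<in> {y \<in> A. adj y x}. \<Phi> (Inr {\<alpha> x, \<alpha> y}))
       + (\<Sum>y \<in> {y \<in> boundary A. adj y x}. \<Phi> (Inr {\<alpha> x, \<omega> y})))"

definition compatible :: "'v cgraph \<Rightarrow> site set \<Rightarrow> (site \<Rightarrow> 'v) \<Rightarrow> (site \<Rightarrow> 'v) set" where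
  "compatible H A \<omega> = {\<alpha> \<in> A \<rightarrow>\<^sub>E verts H. merge A (- A) (\<alpha>, \<omega>) \<in> Hom H}"

definition gibbs :: "'v cgraph \<Rightarrow> 'v interaction \<Rightarrow> site set \<Rightarrow> (site \<Rightarrow> 'v) \<Rightarrow> (site \<Rightarrow> 'v) \<Rightarrow> real" where
  "gibbs H \<Phi> A \<omega> \<alpha> =
     (if \<alpha> \<in> compatible H A \<omega>
      then exp (- energy \<Phi> A \<omega> \<alpha>) / (\<Sum>\<alpha>'\<in>compatible H A \<omega>. exp (- energy \<Phi> A \<omega> \<alpha>'))
      else 0)"

definition gibbs_marginal ::
  "'v cgraph \<Rightarrow> 'v interaction \<Rightarrow> site set \<Rightarrow> (site \<Rightarrow> 'v) \<Rightarrow> site set \<Rightarrow> (site \<Rightarrow> 'v) \<Rightarrow> real" where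
  "gibbs_marginal H \<Phi> A \<omega> B \<beta> =
     (\<Sum>\<alpha> \<in> {\<alpha> \<in> A \<rightarrow>\<^sub>E verts H. restrict \<alpha> B = \<beta>}. gibbs H \<Phi> A \<omega> \<alpha>)"


section \<open>Spatial mixing\<close>

definition decay_function :: "(nat \<Rightarrow> real) \<Rightarrow> bool" where
  "decay_function f \<longleftrightarrow> (\<forall>n. f n \<ge> 0) \<and> decseq f \<and> f \<longlonglongrightarrow> 0"

definition decay_at :: "(nat \<Rightarrow> real) \<Rightarrow> enat \<Rightarrow> real" where
  "decay_at f d = (case d of enat n \<Rightarrow> f n | \<infinity> \<Rightarrow> 0)"

definition SSM_rate :: "'v cgraph \<Rightarrow> 'v interaction \<Rightarrow> (nat \<Rightarrow> real) \<Rightarrow> bool" where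
  "SSM_rate H \<Phi> f \<longleftrightarrow>
     (\<forall>A B. finite A \<longrightarrow> B \<subseteq> A \<longrightarrow>
       (\<forall>\<beta> \<in> B \<rightarrow>\<^sub>E verts H. \<forall>\<omega>\<^sub>1 \<in> Hom H. \<forall>\<omega>\<^sub>2 \<in> Hom H.
         \<bar>gibbs_marginal H \<Phi> A \<omega>\<^sub>1 B \<beta> - gibbs_marginal H \<Phi> A \<omega>\<^sub>2 B \<beta>\<bar>
           \<le> real (card B) * decay_at f (set_dist B (disagreement (boundary A) \<omega>\<^sub>1 \<omega>\<^sub>2))))"

definition WSM_rate :: "'v cgraph \<Rightarrow> 'v interaction \<Rightarrow> (nat \<Rightarrow> real) \<Rightarrow> bool" where
  "WSM_rate H \<Phi> f \<longleftrightarrow>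
     (\<forall>A B. finite A \<longrightarrow> B \<subseteq> A \<longrightarrow>
       (\<forall>\<beta> \<in> B \<rightarrow>\<^sub>E verts H. \<forall>\<omega>\<^sub>1 \<in> Hom H. \<forall>\<omega>\<^sub>2 \<in> Hom H.
         \<bar>gibbs_marginal H \<Phi> A \<omega>\<^sub>1 B \<beta> - gibbs_marginal H \<Phi> A \<omega>\<^sub>2 B \<beta>\<bar>
           \<le> real (card B) * decay_at f (set_dist B (boundary A))))"

definition SSM :: "'v cgraph \<Rightarrow> 'v interaction \<Rightarrow> bool" where
  "SSM H \<Phi> \<longleftrightarrow> (\<exists>f. decay_function f \<and> SSM_rate H \<Phi> f)"

definition exponential_WSM :: "'v cgraph \<Rightarrow> 'v interaction \<Rightarrow> real \<Rightarrow> bool" where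
  "exponential_WSM H \<Phi> \<gamma> \<longleftrightarrow> (\<exists>C>0. WSM_rate H \<Phi> (\<lambda>n. C * exp (- \<gamma> * real n)))"

end

theory Submission
  imports Defs "HOL-Library.Transitive_Closure_Table"
begin

text \<open>
  The graph is the suspension of a path: the path \<open>0 - 1 - 2 - 3\<close> and two further vertices
  \<open>4\<close>, \<open>5\<close>, each joined to the whole path but not to each other, with loops everywhere. The
  path contracts to the vertex \<open>1\<close>, which then absorbs \<open>4\<close> and \<open>5\<close>; so the graph is
  dismantlable.

  The two ends \<open>0\<close> and \<open>3\<close> of the path have only \<open>4\<close> and \<open>5\<close> as common neighbours. Hence,
  in a horizontal corridor of width one between a wall of \<open>0\<close>s and a wall of \<open>3\<close>s, every cell
  is \<open>4\<close> or \<open>5\<close>, and since these are not adjacent, the corridor is constant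
  (\<open>corridor_constant\<close>). Information travels along the corridor undamped over any distance.
  This contradicts topological strong spatial mixing, and it contradicts strong spatial mixing
  for every interaction, because the conditional law is a point mass
  that depends on the far end of the corridor (\<open>not_TSSM_suspended_path\<close>,
  \<open>not_SSM_suspended_path\<close>).

  Weak spatial mixing only concerns sites that are far from all prescribed values, and there
  nothing can be frozen. The vertex \<open>1\<close> is adjacent to everything but \<open>3\<close>, and \<open>2\<close> is adjacent
  to everything that \<open>3\<close> is adjacent to. So one may overwrite a configuration by \<open>1\<close> on any
  set \<open>T\<close> after replacing the \<open>3\<close>s next to \<open>T\<close> by \<open>2\<close>s. If each site with value \<open>1\<close> is
  rewarded by a factor \<open>L\<close>, this gains \<open>L\<close> per site of \<open>T\<close>, while at most \<open>6 ^ 5\<close>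
  configurations per site of \<open>T\<close> are identified; therefore \<open>1\<close> is avoided on all of \<open>T\<close> with
  probability at most \<open>(6 ^ 5 / L) ^ card T\<close> (\<open>non_1_rare\<close>).

  To compare two boundary conditions, sample from the two Gibbs measures independently and let
  \<open>C\<close> be the union of those clusters of disagreeing sites that meet \<open>B\<close>. If \<open>C\<close> does not
  touch the outside of \<open>A\<close>, exchanging the two samples on \<open>C\<close> preserves the product measure
  and swaps their restrictions to \<open>B\<close>. So the marginals on \<open>B\<close> differ by at most the
  probability that \<open>C\<close> reaches the outside (\<open>marginal_difference_le\<close>). This requires a long
  self-avoiding walk on which, at every site, one of the samples is not \<open>1\<close>; there are
  exponentially many walks, but for large \<open>L\<close> each is exponentially less likely
  (\<open>marginal_difference_le_power\<close>).
\<close>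

section \<open>Distances and walks in the square lattice\<close>

definition l1 :: "site \<Rightarrow> site \<Rightarrow> nat" where
  "l1 x y = nat (\<bar>fst x - fst y\<bar> + \<bar>snd x - snd y\<bar>)"

lemma l1_eq_0_iff: "l1 x y = 0 \<longleftrightarrow> x = y"
  unfolding l1_def prod_eq_iff by linarith

lemma l1_triangle: "l1 x z \<le> l1 x y + l1 y z"
  unfolding l1_def by linarith

lemma adj_iff_l1: "adj x y \<longleftrightarrow> l1 x y = 1"
  unfolding l1_def adj_def by linarith

lemma adj_sym: "adj x y \<longleftrightarrow> adj y x"
  unfolding adj_def by linarith

lemma neighbours_eq: "{y. adj x y} =
    {(fst x + 1, snd x), (fst x - 1, snd x), (fst x, snd x + 1), (fst x, snd x - 1)}"
proof -
  have "\<bar>a - c\<bar> + \<bar>b - d\<bar> = 1 \<longleftrightarrow>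
      c = a + 1 \<and> d = b \<or> c = a - 1 \<and> d = b \<or> c = a \<and> d = b + 1 \<or> c = a \<and> d = b - 1"
    for a b c d :: int by arith
  then show ?thesis by (cases x) (auto simp: adj_def)
qed

lemma finite_neighbours: "finite {y. adj x y}"
  by (simp add: neighbours_eq)

lemma card_neighbours_le: "card {y. adj x y} \<le> 4"
  unfolding neighbours_eq by (intro order.trans[OF card_insert_le_m1]) auto

lemma l1_step_back:
  assumes "l1 x y = Suc m"
  shows "\<exists>z. adj z y \<and> l1 x z = m"
proof -
  obtain a b c d where xy: "x = (a, b)" "y = (c, d)" by fastforce
  consider "c < a" | "c > a" | "d < b" | "d > b" | "a = c \<and> b = d" by linarith
  then show ?thesis
  proof cases
    case 1 then show ?thesis using assms unfolding xy
      by (intro exI[of _ "(c + 1, d)"]) (simp add: adj_def l1_def)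
  next
    case 2 then show ?thesis using assms unfolding xy
      by (intro exI[of _ "(c - 1, d)"]) (simp add: adj_def l1_def)
  next
    case 3 then show ?thesis using assms unfolding xy
      by (intro exI[of _ "(c, d + 1)"]) (simp add: adj_def l1_def)
  next
    case 4 then show ?thesis using assms unfolding xy
      by (intro exI[of _ "(c, d - 1)"]) (simp add: adj_def l1_def)
  next
    case 5 then show ?thesis using assms unfolding xy by (simp add: l1_def)
  qed
qed

lemma site_dist_eq_l1: "site_dist x y = l1 x y"
  unfolding site_dist_def
proof (rule Least_equality)
  show "(adj ^^ l1 x y) x y"
  proof (induction "l1 x y" arbitrary: y)
    case 0
    then have "x = y" using l1_eq_0_iff[of x y] by simp
    with 0 show ?case by (metis relpowp_0_I)
  next
    case (Suc m)
    then obtain z where "adj z y" "l1 x z = m" by (metis l1_step_back)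
    with Suc show ?case by (metis relpowp_Suc_I)
  qed
next
  show "l1 x y \<le> n" if "(adj ^^ n) x y" for n
    using that
  proof (induction n arbitrary: y)
    case 0
    then show ?case by (simp add: l1_def)
  next
    case (Suc n)
    then obtain z where "(adj ^^ n) x z" "adj z y" by auto
    then show ?case using Suc.IH[of z] l1_triangle[of x y z] adj_iff_l1[of z y] by simp
  qed
qed

lemma set_dist_ge_iff: "enat n \<le> set_dist A B \<longleftrightarrow> (\<forall>x\<in>A. \<forall>y\<in>B. n \<le> l1 x y)"
  by (simp add: set_dist_def site_dist_eq_l1 le_INF_iff)

lemma set_dist_le: "x \<in> A \<Longrightarrow> y \<in> B \<Longrightarrow> set_dist A B \<le> enat (l1 x y)"
  unfolding set_dist_def site_dist_eq_l1 by (meson INF_lower2 INF_lower)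

lemma boundary_disjoint: "x \<in> boundary A \<Longrightarrow> x \<notin> A"
proof
  assume "x \<in> boundary A" "x \<in> A"
  then show False
    using set_dist_le[of x "{x}" x A] by (simp add: boundary_def l1_def flip: zero_enat_def)
qed

lemma in_boundary:
  assumes "x \<notin> A" "y \<in> A" "adj x y"
  shows "x \<in> boundary A"
proof -
  have "1 \<le> l1 x z" if "z \<in> A" for z
  proof -
    have "x \<noteq> z" using that assms by auto
    then show ?thesis using l1_eq_0_iff[of x z] by linarith
  qed
  then have "enat 1 \<le> set_dist {x} A" by (simp add: set_dist_ge_iff)
  moreover have "set_dist {x} A \<le> enat 1"
    using set_dist_le[of x "{x}" y A] assms by (simp add: adj_iff_l1)
  ultimately show ?thesis by (simp add: boundary_def one_enat_def)
qed

text \<open>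
  A shortest path from \<open>b\<close> to a site outside \<open>A\<close> has to cross the boundary of \<open>A\<close>.
\<close>

lemma near_imp_inside:
  assumes "B \<subseteq> A" "b \<in> B" "enat (l1 b y) < set_dist B (boundary A)"
  shows "y \<in> A"
  using assms(3)
proof (induction "l1 b y" arbitrary: y)
  case 0
  then have "b = y" using l1_eq_0_iff[of b y] by simp
  then show ?case using assms by auto
next
  case (Suc m)
  then obtain z where z: "adj z y" "l1 b z = m" by (metis l1_step_back)
  then have "enat (l1 b z) < set_dist B (boundary A)"
    using Suc by (metis enat_ord_simps(2) lessI less_trans)
  then have "z \<in> A" using Suc.hyps(1) z by auto
  show ?case
  proof (rule ccontr)
    assume "y \<notin> A"
    then have "y \<in> boundary A" using in_boundary \<open>z \<in> A\<close> z adj_sym by blast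
    then show False using set_dist_le[OF assms(2), of y "boundary A"] Suc.prems by simp
  qed
qed

text \<open>
  The parameter \<open>m\<close> counts sites, not steps. The nonempty walks start at \<open>x\<close>, the
  neighbour \<open>y\<close> that would follow the last site is chosen and then dropped.
\<close>

fun walks :: "site \<Rightarrow> nat \<Rightarrow> site list set" where
  "walks x 0 = {[]}"
| "walks x (Suc m) = (\<Union>y\<in>{y. adj x y}. (#) x ` walks y m)"

lemma finite_walks: "finite (walks x m)"
  by (induction m arbitrary: x) (auto simp: finite_neighbours)

lemma length_walks: "xs \<in> walks x m \<Longrightarrow> length xs = m"
  by (induction m arbitrary: x xs) auto

lemma card_walks_le: "card (walks x m) \<le> 4 ^ m"
proof (induction m arbitrary: x)
  case (Suc m)
  have "card (walks x (Suc m)) \<le> (\<Sum>y\<in>{y. adj x y}. card ((#) x ` walks y m))"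
    unfolding walks.simps by (intro card_UN_le finite_neighbours)
  also have "\<dots> \<le> (\<Sum>y\<in>{y. adj x y}. 4 ^ m)"
    by (intro sum_mono order.trans[OF card_image_le[OF finite_walks] Suc])
  also have "\<dots> \<le> 4 ^ Suc m" using card_neighbours_le[of x] by simp
  finally show ?case .
qed simp

lemma walks_near: "xs \<in> walks x m \<Longrightarrow> y \<in> set xs \<Longrightarrow> l1 x y < m"
proof (induction m arbitrary: x xs)
  case (Suc m)
  then obtain z ys where ys: "adj x z" "ys \<in> walks z m" "xs = x # ys" by auto
  show ?case
  proof (cases "y = x")
    case True then show ?thesis by (simp add: l1_def)
  next
    case False
    then have "l1 z y < m" using Suc ys by auto
    then show ?thesis using l1_triangle[of x y z] ys by (simp add: adj_iff_l1)
  qed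
qed simp

text \<open>
  A path that leads to distance at least \<open>m\<close> has at least \<open>m\<close> steps; its first \<open>m\<close> sites
  form the walk.
\<close>

lemma walk_prefix:
  assumes "rtrancl_path r x xs z" "\<And>u v. r u v \<Longrightarrow> adj u v" "m \<le> l1 x z"
  shows "take m (x # xs) \<in> walks x m"
  using assms(1,3)
proof (induction arbitrary: m)
  case (base x)
  then show ?case by (simp add: l1_def)
next
  case (step x y ys z)
  show ?case
  proof (cases m)
    case (Suc k)
    have "adj x y" using step assms(2) by blast
    moreover have "take k (y # ys) \<in> walks y k"
      using step Suc l1_triangle[of x z y] \<open>adj x y\<close> by (simp add: adj_iff_l1)
    ultimately show ?thesis unfolding Suc take_Suc_Cons walks.simps by blast
  qed simp
qed

section \<open>Gibbs measures\<close>

lemma HomI: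
  assumes "\<And>x. \<omega> x \<in> verts H" "\<And>x y. adj x y \<Longrightarrow> {\<omega> x, \<omega> y} \<in> edges H"
  shows "\<omega> \<in> Hom H"
  using assms by (simp add: Hom_def)

lemma Hom_edge: "\<omega> \<in> Hom H \<Longrightarrow> adj x y \<Longrightarrow> {\<omega> x, \<omega> y} \<in> edges H"
  unfolding Hom_def by blast

lemma Hom_vert: "\<omega> \<in> Hom H \<Longrightarrow> \<omega> x \<in> verts H"
  unfolding Hom_def by blast

lemma merge_compl: "merge A (- A) (\<alpha>, \<omega>) = (\<lambda>x. if x \<in> A then \<alpha> x else \<omega> x)"
  by (auto simp: merge_def)

text \<open>
  Edges outside \<open>A\<close> are already taken care of by \<open>\<omega>\<close>, so only the edges that meet \<open>A\<close> need to be
  inspected when a configuration is modified.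
\<close>

lemma compatible_iff:
  assumes "\<omega> \<in> Hom H"
  shows "\<alpha> \<in> compatible H A \<omega> \<longleftrightarrow> \<alpha> \<in> A \<rightarrow>\<^sub>E verts H \<and>
    (\<forall>x\<in>A. \<forall>y\<in>A. adj x y \<longrightarrow> {\<alpha> x, \<alpha> y} \<in> edges H) \<and>
    (\<forall>x\<in>A. \<forall>y\<in>-A. adj x y \<longrightarrow> {\<alpha> x, \<omega> y} \<in> edges H)" (is "_ \<longleftrightarrow> ?R")
proof
  assume *: "\<alpha> \<in> compatible H A \<omega>"
  then have "adj x y \<Longrightarrow> {if x \<in> A then \<alpha> x else \<omega> x, if y \<in> A then \<alpha> y else \<omega> y} \<in> edges H" for x y
    using Hom_edge unfolding compatible_def merge_compl by blast
  then show ?R using * unfolding compatible_def by fastforce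
next
  assume R: ?R
  have "merge A (- A) (\<alpha>, \<omega>) \<in> Hom H" unfolding merge_compl
  proof (rule HomI)
    show "(if x \<in> A then \<alpha> x else \<omega> x) \<in> verts H" for x
      using R Hom_vert[OF assms] by auto
    show "{if x \<in> A then \<alpha> x else \<omega> x, if y \<in> A then \<alpha> y else \<omega> y} \<in> edges H" if "adj x y" for x y
    proof (cases "x \<in> A \<or> y \<notin> A")
      case True
      then show ?thesis using R that Hom_edge[OF assms that] by simp blast
    next
      case False
      then have "{\<alpha> y, \<omega> x} \<in> edges H" using R that adj_sym[of x y] by blast
      then show ?thesis using False by (simp add: insert_commute)
    qed
  qed
  with R show "\<alpha> \<in> compatible H A \<omega>" by (simp add: compatible_def)
qed

lemma compatible_subset: "compatible H A \<omega> \<subseteq> A \<rightarrow>\<^sub>E verts H"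
  by (auto simp: compatible_def)

lemma finite_compatible: "finite (verts H) \<Longrightarrow> finite A \<Longrightarrow> finite (compatible H A \<omega>)"
  by (rule finite_subset[OF compatible_subset]) (simp add: finite_PiE)

lemma restrict_compatible: "\<omega> \<in> Hom H \<Longrightarrow> restrict \<omega> A \<in> compatible H A \<omega>"
  by (auto simp: compatible_iff Hom_edge Hom_vert)

lemma partition_function_pos:
  assumes "finite (verts H)" "finite A" "\<omega> \<in> Hom H"
  shows "0 < (\<Sum>\<alpha>\<in>compatible H A \<omega>. exp (- energy \<Phi> A \<omega> \<alpha>))"
  using assms restrict_compatible by (intro sum_pos finite_compatible) auto

lemma gibbs_nonneg: "0 \<le> gibbs H \<Phi> A \<omega> \<alpha>"
  by (simp add: gibbs_def sum_nonneg)

lemma sum_gibbs: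
  assumes "finite (verts H)" "finite A" "\<omega> \<in> Hom H"
  shows "(\<Sum>\<alpha>\<in>compatible H A \<omega>. gibbs H \<Phi> A \<omega> \<alpha>) = 1"
  using partition_function_pos[OF assms, of \<Phi>] by (simp add: gibbs_def flip: sum_divide_distrib)

lemma gibbs_marginal_eq:
  assumes "finite (verts H)" "finite A"
  shows "gibbs_marginal H \<Phi> A \<omega> B \<beta> =
    (\<Sum>\<alpha> | \<alpha> \<in> compatible H A \<omega> \<and> restrict \<alpha> B = \<beta>. gibbs H \<Phi> A \<omega> \<alpha>)"
  unfolding gibbs_marginal_def
proof (rule sum.mono_neutral_right)
  show "finite {\<alpha> \<in> A \<rightarrow>\<^sub>E verts H. restrict \<alpha> B = \<beta>}"
    using assms by (auto intro!: finite_PiE)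
qed (auto simp: gibbs_def compatible_def)

section \<open>Exchanging two samples on their disagreement cluster\<close>

definition links :: "site set \<Rightarrow> site \<Rightarrow> site \<Rightarrow> bool" where
  "links D x y \<longleftrightarrow> x \<in> D \<and> y \<in> D \<and> adj x y"

definition cluster :: "site set \<Rightarrow> site set \<Rightarrow> site set" where
  "cluster B D = {y. \<exists>b\<in>B \<inter> D. (links D)\<^sup>*\<^sup>* b y}"

lemma cluster_subset: "cluster B D \<subseteq> D"
proof
  fix y assume "y \<in> cluster B D"
  then obtain b where "b \<in> D" "(links D)\<^sup>*\<^sup>* b y" by (auto simp: cluster_def)
  from this(2,1) show "y \<in> D" by (cases rule: rtranclp.cases) (auto simp: links_def)
qed

lemma subset_cluster: "B \<inter> D \<subseteq> cluster B D"
  by (auto simp: cluster_def)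

lemma cluster_closed:
  assumes "x \<in> cluster B D" "adj x y" "y \<in> D"
  shows "y \<in> cluster B D"
proof -
  have "links D x y" using assms cluster_subset by (auto simp: links_def)
  with assms show ?thesis unfolding cluster_def by (blast intro: rtranclp.rtrancl_into_rtrancl)
qed

definition neighbours_within :: "site set \<Rightarrow> site set \<Rightarrow> bool" where
  "neighbours_within C A \<longleftrightarrow> (\<forall>x\<in>C. \<forall>y. adj x y \<longrightarrow> y \<in> A)"

definition exchange :: "site set \<Rightarrow> (site \<Rightarrow> 'v) \<times> (site \<Rightarrow> 'v) \<Rightarrow> (site \<Rightarrow> 'v) \<times> (site \<Rightarrow> 'v)" where
  "exchange C p = (\<lambda>x. if x \<in> C then snd p x else fst p x, \<lambda>x. if x \<in> C then fst p x else snd p x)"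

lemma fst_exchange: "fst (exchange C p) x = (if x \<in> C then snd p x else fst p x)"
  and snd_exchange: "snd (exchange C p) x = (if x \<in> C then fst p x else snd p x)"
  by (simp_all add: exchange_def)

lemma exchange_exchange: "exchange C (exchange C p) = p"
  by (rule prod_eqI) (auto simp: fst_exchange snd_exchange)

lemma disagreement_exchange:
  "disagreement A (fst (exchange C p)) (snd (exchange C p)) = disagreement A (fst p) (snd p)"
  by (auto simp: disagreement_def fst_exchange snd_exchange)

text \<open>
  \<open>C\<close> stays inside \<open>A\<close> together with its neighbours, and the two configurations agree on
  its outer boundary. So no edge that meets \<open>C\<close> notices which of the two configurations is
  used outside \<open>C\<close>, and exchanging them on \<open>C\<close> costs nothing.
\<close>

locale isolated_cluster =
  fixes A C :: "site set" and p :: "(site \<Rightarrow> 'v) \<times> (site \<Rightarrow> 'v)"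
  assumes sub: "C \<subseteq> A" and within: "neighbours_within C A"
    and outer: "\<And>x y. x \<in> C \<Longrightarrow> adj x y \<Longrightarrow> y \<notin> C \<Longrightarrow> fst p y = snd p y"
begin

lemma pair_cases:
  assumes "adj x y"
  obtains "fst (exchange C p) x = fst p x" "fst (exchange C p) y = fst p y"
      "snd (exchange C p) x = snd p x" "snd (exchange C p) y = snd p y"
    | "fst (exchange C p) x = snd p x" "fst (exchange C p) y = snd p y"
      "snd (exchange C p) x = fst p x" "snd (exchange C p) y = fst p y"
  using assms outer[of x y] outer[of y x] adj_sym[of x y]
  by (cases "x \<in> C"; cases "y \<in> C") (auto simp: fst_exchange snd_exchange)

lemma exchange_compatible:
  assumes "\<omega>\<^sub>1 \<in> Hom H" "\<omega>\<^sub>2 \<in> Hom H" "p \<in> compatible H A \<omega>\<^sub>1 \<times> compatible H A \<omega>\<^sub>2"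
  shows "exchange C p \<in> compatible H A \<omega>\<^sub>1 \<times> compatible H A \<omega>\<^sub>2"
proof -
  have p: "fst p \<in> compatible H A \<omega>\<^sub>1" "snd p \<in> compatible H A \<omega>\<^sub>2" using assms by auto
  note p1 = p(1)[unfolded compatible_iff[OF assms(1)]]
  note p2 = p(2)[unfolded compatible_iff[OF assms(2)]]
  have "fst (exchange C p) \<in> A \<rightarrow>\<^sub>E verts H" "snd (exchange C p) \<in> A \<rightarrow>\<^sub>E verts H"
    using p1 p2 sub by (auto simp: fst_exchange snd_exchange PiE_iff extensional_def)
  moreover have "{fst (exchange C p) x, fst (exchange C p) y} \<in> edges H \<and>
      {snd (exchange C p) x, snd (exchange C p) y} \<in> edges H" if "x \<in> A" "y \<in> A" "adj x y" for x y
    using that p1 p2 by (cases rule: pair_cases[OF that(3)]) auto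
  moreover have "{fst (exchange C p) x, \<omega>\<^sub>1 y} \<in> edges H \<and> {snd (exchange C p) x, \<omega>\<^sub>2 y} \<in> edges H"
    if "x \<in> A" "y \<in> - A" "adj x y" for x y
  proof -
    have "x \<notin> C" using that within unfolding neighbours_within_def by blast
    then show ?thesis using that p1 p2 by (auto simp: fst_exchange snd_exchange)
  qed
  ultimately show ?thesis
    using assms by (simp add: mem_Times_iff compatible_iff)
qed

text \<open>
  On each edge inside \<open>A\<close> the exchange either keeps both configurations or swaps them, so the two
  edge terms have the same sum as before; edges to the boundary of \<open>A\<close> do not meet \<open>C\<close>.
\<close>

lemma exchange_energy:
  "energy \<Phi> A \<omega>\<^sub>1 (fst (exchange C p)) + energy \<Phi> A \<omega>\<^sub>2 (snd (exchange C p)) =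
   energy \<Phi> A \<omega>\<^sub>1 (fst p) + energy \<Phi> A \<omega>\<^sub>2 (snd p)"
proof -
  let ?q = "exchange C p"
  have split: "energy \<Phi> A \<omega>\<^sub>1 (fst r) + energy \<Phi> A \<omega>\<^sub>2 (snd r) = 
    (\<Sum>x\<in>A. (\<Phi> (Inl (fst r x)) + \<Phi> (Inl (snd r x)))
      + 1/2 * (\<Sum>y \<in> {y \<in> A. adj y x}. \<Phi> (Inr {fst r x, fst r y}) + \<Phi> (Inr {snd r x, snd r y}))
      + (\<Sum>y \<in> {y \<in> boundary A. adj y x}. \<Phi> (Inr {fst r x, \<omega>\<^sub>1 y}) + \<Phi> (Inr {snd r x, \<omega>\<^sub>2 y})))" for r
    unfolding energy_def by (simp add: sum.distrib algebra_simps add_divide_distrib)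
  have self: "\<Phi> (Inl (fst ?q x)) + \<Phi> (Inl (snd ?q x)) = \<Phi> (Inl (fst p x)) + \<Phi> (Inl (snd p x))" for x
    by (simp add: fst_exchange snd_exchange)
  have inner: "(\<Sum>y \<in> {y \<in> A. adj y x}. \<Phi> (Inr {fst ?q x, fst ?q y}) + \<Phi> (Inr {snd ?q x, snd ?q y})) =
      (\<Sum>y \<in> {y \<in> A. adj y x}. \<Phi> (Inr {fst p x, fst p y}) + \<Phi> (Inr {snd p x, snd p y}))" for x
  proof (rule sum.cong[OF refl])
    fix y assume "y \<in> {y \<in> A. adj y x}"
    then have "adj x y" using adj_sym[of x y] by simp
    then show "\<Phi> (Inr {fst ?q x, fst ?q y}) + \<Phi> (Inr {snd ?q x, snd ?q y}) =
        \<Phi> (Inr {fst p x, fst p y}) + \<Phi> (Inr {snd p x, snd p y})"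
      by (cases rule: pair_cases) auto
  qed
  have border: "(\<Sum>y \<in> {y \<in> boundary A. adj y x}. \<Phi> (Inr {fst ?q x, \<omega>\<^sub>1 y}) + \<Phi> (Inr {snd ?q x, \<omega>\<^sub>2 y})) =
      (\<Sum>y \<in> {y \<in> boundary A. adj y x}. \<Phi> (Inr {fst p x, \<omega>\<^sub>1 y}) + \<Phi> (Inr {snd p x, \<omega>\<^sub>2 y}))" for x
  proof (rule sum.cong[OF refl])
    fix y assume "y \<in> {y \<in> boundary A. adj y x}"
    then have "x \<notin> C" using within boundary_disjoint[of y A] adj_sym[of x y]
      unfolding neighbours_within_def by blast
    then show "\<Phi> (Inr {fst ?q x, \<omega>\<^sub>1 y}) + \<Phi> (Inr {snd ?q x, \<omega>\<^sub>2 y}) =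
        \<Phi> (Inr {fst p x, \<omega>\<^sub>1 y}) + \<Phi> (Inr {snd p x, \<omega>\<^sub>2 y})"
      by (simp add: fst_exchange snd_exchange)
  qed
  show ?thesis by (simp only: split self inner border)
qed

lemma exchange_gibbs:
  assumes "\<omega>\<^sub>1 \<in> Hom H" "\<omega>\<^sub>2 \<in> Hom H" "p \<in> compatible H A \<omega>\<^sub>1 \<times> compatible H A \<omega>\<^sub>2"
  shows "gibbs H \<Phi> A \<omega>\<^sub>1 (fst (exchange C p)) * gibbs H \<Phi> A \<omega>\<^sub>2 (snd (exchange C p)) =
    gibbs H \<Phi> A \<omega>\<^sub>1 (fst p) * gibbs H \<Phi> A \<omega>\<^sub>2 (snd p)"
proof -
  have "exp (- energy \<Phi> A \<omega>\<^sub>1 (fst (exchange C p))) * exp (- energy \<Phi> A \<omega>\<^sub>2 (snd (exchange C p))) =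
      exp (- energy \<Phi> A \<omega>\<^sub>1 (fst p)) * exp (- energy \<Phi> A \<omega>\<^sub>2 (snd p))"
    using exchange_energy[of \<Phi> \<omega>\<^sub>1 \<omega>\<^sub>2] by (simp flip: exp_add minus_add)
  then show ?thesis
    using assms(3) exchange_compatible[OF assms] by (simp add: gibbs_def mem_Times_iff)
qed

end

lemma isolated_disagreement_cluster:
  assumes "neighbours_within (cluster B (disagreement A (fst p) (snd p))) A"
  shows "isolated_cluster A (cluster B (disagreement A (fst p) (snd p))) p"
proof
  let ?D = "disagreement A (fst p) (snd p)"
  show "cluster B ?D \<subseteq> A"
    using cluster_subset[of B ?D] by (auto simp: disagreement_def)
  show "fst p y = snd p y" if "x \<in> cluster B ?D" "adj x y" "y \<notin> cluster B ?D" for x y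
  proof -
    have "y \<in> A" using assms that unfolding neighbours_within_def by blast
    moreover have "y \<notin> ?D" using cluster_closed that by blast
    ultimately show ?thesis by (simp add: disagreement_def)
  qed
qed (fact assms)

text \<open>
  On the event that the cluster keeps away from the complement of \<open>A\<close>, the exchange is an
  involution that preserves the product measure. It swaps the restrictions to \<open>B\<close>: a site
  of \<open>B\<close> outside the cluster is a site of agreement. Hence on this event both marginals receive
  the same mass, and only the complementary event contributes to their difference.
\<close>

lemma marginal_difference_le:
  assumes "finite (verts H)" "finite A" "B \<subseteq> A" "\<omega>\<^sub>1 \<in> Hom H" "\<omega>\<^sub>2 \<in> Hom H"
  shows "\<bar>gibbs_marginal H \<Phi> A \<omega>\<^sub>1 B \<beta> - gibbs_marginal H \<Phi> A \<omega>\<^sub>2 B \<beta>\<bar> \<le>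
    (\<Sum>p | p \<in> compatible H A \<omega>\<^sub>1 \<times> compatible H A \<omega>\<^sub>2 \<and>
        \<not> neighbours_within (cluster B (disagreement A (fst p) (snd p))) A.
      gibbs H \<Phi> A \<omega>\<^sub>1 (fst p) * gibbs H \<Phi> A \<omega>\<^sub>2 (snd p))"
proof -
  define X where "X = compatible H A \<omega>\<^sub>1 \<times> compatible H A \<omega>\<^sub>2"
  define \<mu> where "\<mu> p = gibbs H \<Phi> A \<omega>\<^sub>1 (fst p) * gibbs H \<Phi> A \<omega>\<^sub>2 (snd p)" for p
  define D where "D p = disagreement A (fst p) (snd p)" for p :: "(site \<Rightarrow> 'a) \<times> (site \<Rightarrow> 'a)"
  define G where "G = {p \<in> X. neighbours_within (cluster B (D p)) A}"
  define P\<^sub>1 where "P\<^sub>1 = {p \<in> X. restrict (fst p) B = \<beta>}"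
  define P\<^sub>2 where "P\<^sub>2 = {p \<in> X. restrict (snd p) B = \<beta>}"
  define swap where "swap p = exchange (cluster B (D p)) p" for p :: "(site \<Rightarrow> 'a) \<times> (site \<Rightarrow> 'a)"
  have fin: "finite X"
    unfolding X_def using assms by (intro finite_cartesian_product finite_compatible)
  have \<mu>_nonneg: "0 \<le> \<mu> p" for p by (simp add: \<mu>_def gibbs_nonneg)

  have "gibbs_marginal H \<Phi> A \<omega>\<^sub>1 B \<beta> =
      (\<Sum>\<alpha> | \<alpha> \<in> compatible H A \<omega>\<^sub>1 \<and> restrict \<alpha> B = \<beta>. gibbs H \<Phi> A \<omega>\<^sub>1 \<alpha>) *
      (\<Sum>\<alpha>\<in>compatible H A \<omega>\<^sub>2. gibbs H \<Phi> A \<omega>\<^sub>2 \<alpha>)"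
    using assms by (simp add: gibbs_marginal_eq sum_gibbs)
  also have "\<dots> = sum \<mu> P\<^sub>1"
    unfolding sum_product sum.cartesian_product \<mu>_def
    by (intro sum.cong) (auto simp: P\<^sub>1_def X_def)
  finally have marg1: "gibbs_marginal H \<Phi> A \<omega>\<^sub>1 B \<beta> = sum \<mu> P\<^sub>1" .
  have "gibbs_marginal H \<Phi> A \<omega>\<^sub>2 B \<beta> =
      (\<Sum>\<alpha>\<in>compatible H A \<omega>\<^sub>1. gibbs H \<Phi> A \<omega>\<^sub>1 \<alpha>) *
      (\<Sum>\<alpha> | \<alpha> \<in> compatible H A \<omega>\<^sub>2 \<and> restrict \<alpha> B = \<beta>. gibbs H \<Phi> A \<omega>\<^sub>2 \<alpha>)"
    using assms by (simp add: gibbs_marginal_eq sum_gibbs)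
  also have "\<dots> = sum \<mu> P\<^sub>2"
    unfolding sum_product sum.cartesian_product \<mu>_def
    by (intro sum.cong) (auto simp: P\<^sub>2_def X_def)
  finally have marg2: "gibbs_marginal H \<Phi> A \<omega>\<^sub>2 B \<beta> = sum \<mu> P\<^sub>2" .

  have D_swap: "D (swap p) = D p" for p
    by (simp add: D_def swap_def disagreement_exchange)
  have swap_swap: "swap (swap p) = p" for p
  proof -
    have "swap (swap p) = exchange (cluster B (D p)) (swap p)"
      unfolding swap_def[of "swap p"] D_swap ..
    then show ?thesis by (simp add: swap_def exchange_exchange)
  qed
  have isolated: "isolated_cluster A (cluster B (D p)) p" if "p \<in> G" for p
    using that isolated_disagreement_cluster[of B A p] by (simp add: G_def D_def)
  have swap_G: "swap p \<in> G" if "p \<in> G" for p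
  proof -
    have "swap p \<in> X"
      unfolding swap_def X_def
      using that assms by (intro isolated_cluster.exchange_compatible[OF isolated]) (auto simp: G_def X_def)
    then show ?thesis using that by (simp add: G_def D_swap)
  qed
  have swap_\<mu>: "\<mu> (swap p) = \<mu> p" if "p \<in> G" for p
    unfolding swap_def \<mu>_def
    using that assms by (intro isolated_cluster.exchange_gibbs[OF isolated]) (auto simp: G_def X_def)
  have swap_restrict: "restrict (fst (swap p)) B = restrict (snd p) B"
    "restrict (snd (swap p)) B = restrict (fst p) B" for p
  proof -
    have "fst p x = snd p x" if "x \<in> B" "x \<notin> cluster B (D p)" for x
      using that assms(3) subset_cluster[of B "D p"] by (auto simp: D_def disagreement_def)
    then show "restrict (fst (swap p)) B = restrict (snd p) B"
      "restrict (snd (swap p)) B = restrict (fst p) B"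
      by (auto simp: swap_def fst_exchange snd_exchange restrict_def)
  qed
  have "sum \<mu> (P\<^sub>1 \<inter> G) = sum \<mu> (P\<^sub>2 \<inter> G)"
  proof (rule sum.reindex_bij_witness[where i = swap and j = swap])
    fix p assume "p \<in> P\<^sub>1 \<inter> G"
    then show "swap p \<in> P\<^sub>2 \<inter> G"
      using swap_G[of p] by (auto simp: P\<^sub>1_def P\<^sub>2_def swap_restrict G_def)
  next
    fix p assume "p \<in> P\<^sub>2 \<inter> G"
    then show "swap p \<in> P\<^sub>1 \<inter> G"
      using swap_G[of p] by (auto simp: P\<^sub>1_def P\<^sub>2_def swap_restrict G_def)
  qed (auto simp: swap_swap swap_\<mu>)
  moreover have "sum \<mu> P = sum \<mu> (P \<inter> G) + sum \<mu> (P - G)" if "P \<subseteq> X" for P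
    using finite_subset[OF that fin] by (simp add: sum.Int_Diff)
  moreover have "0 \<le> sum \<mu> (P - G)" "sum \<mu> (P - G) \<le> sum \<mu> (X - G)" if "P \<subseteq> X" for P
    using that fin \<mu>_nonneg by (auto intro!: sum_nonneg sum_mono2)
  moreover have "P\<^sub>1 \<subseteq> X" "P\<^sub>2 \<subseteq> X" by (auto simp: P\<^sub>1_def P\<^sub>2_def)
  ultimately have "\<bar>sum \<mu> P\<^sub>1 - sum \<mu> P\<^sub>2\<bar> \<le> sum \<mu> (X - G)" by (smt (verit))
  also have "X - G = {p \<in> X. \<not> neighbours_within (cluster B (D p)) A}" by (auto simp: G_def)
  finally show ?thesis unfolding marg1 marg2 X_def \<mu>_def D_def .
qed

section \<open>Counting walks of disagreement\<close>

lemma escaping_walk: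
  assumes "\<not> neighbours_within (cluster B D) A"
    and ball: "\<And>b y. b \<in> B \<Longrightarrow> l1 b y \<le> m \<Longrightarrow> y \<in> A"
  shows "\<exists>b\<in>B. \<exists>xs\<in>walks b m. distinct xs \<and> set xs \<subseteq> D"
proof -
  obtain y z where "y \<in> cluster B D" "adj y z" "z \<notin> A"
    using assms(1) unfolding neighbours_within_def by blast
  then obtain b where b: "b \<in> B" "b \<in> D" "(links D)\<^sup>*\<^sup>* b y" by (auto simp: cluster_def)
  then obtain ys' where "rtrancl_path (links D) b ys' y" by (auto simp: rtranclp_eq_rtrancl_path)
  then obtain ys where path: "rtrancl_path (links D) b ys y" and dist: "distinct (b # ys)"
    by (rule rtrancl_path_distinct)
  have "\<not> l1 b z \<le> m" using ball b \<open>z \<notin> A\<close> by blast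
  then have far: "m \<le> l1 b y"
    using l1_triangle[of b z y] adj_iff_l1[of y z] \<open>adj y z\<close> by linarith
  have "set ys \<subseteq> D" using path by induction (auto simp: links_def)
  then have "set (take m (b # ys)) \<subseteq> D" using b set_take_subset[of m "b # ys"] by auto
  moreover have "take m (b # ys) \<in> walks b m"
    using walk_prefix[OF path _ far] by (simp add: links_def)
  ultimately show ?thesis using b dist distinct_take by blast
qed

text \<open>
  Where the two samples disagree, one of them differs from \<open>r\<close>. Splitting \<open>T\<close> into the set \<open>U\<close>
  where the first sample differs from \<open>r\<close> and the rest, where the second one must, independence
  gives \<open>q ^ card U * q ^ card (T - U)\<close> for each of the \<open>2 ^ card T\<close> sets \<open>U\<close>.
\<close>

lemma disagreement_set_le:
  assumes H: "finite (verts H)" "finite A" and T: "finite T" and "0 \<le> q"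
    and rare\<^sub>1: "\<And>U. U \<subseteq> T \<Longrightarrow>
      (\<Sum>\<alpha> | \<alpha> \<in> compatible H A \<omega>\<^sub>1 \<and> (\<forall>x\<in>U. \<alpha> x \<noteq> r). gibbs H \<Phi> A \<omega>\<^sub>1 \<alpha>) \<le> q ^ card U"
    and rare\<^sub>2: "\<And>U. U \<subseteq> T \<Longrightarrow>
      (\<Sum>\<alpha> | \<alpha> \<in> compatible H A \<omega>\<^sub>2 \<and> (\<forall>x\<in>U. \<alpha> x \<noteq> r). gibbs H \<Phi> A \<omega>\<^sub>2 \<alpha>) \<le> q ^ card U"
  shows "(\<Sum>p | p \<in> compatible H A \<omega>\<^sub>1 \<times> compatible H A \<omega>\<^sub>2 \<and> T \<subseteq> disagreement A (fst p) (snd p).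
      gibbs H \<Phi> A \<omega>\<^sub>1 (fst p) * gibbs H \<Phi> A \<omega>\<^sub>2 (snd p)) \<le> (2 * q) ^ card T"
proof -
  define E where "E \<omega> U = {\<alpha> \<in> compatible H A \<omega>. \<forall>x\<in>U. \<alpha> x \<noteq> r}" for \<omega> U
  define \<mu> where "\<mu> p = gibbs H \<Phi> A \<omega>\<^sub>1 (fst p) * gibbs H \<Phi> A \<omega>\<^sub>2 (snd p)" for p
  define P where "P = {p \<in> compatible H A \<omega>\<^sub>1 \<times> compatible H A \<omega>\<^sub>2. T \<subseteq> disagreement A (fst p) (snd p)}"
  have finE: "finite (E \<omega> U)" for \<omega> U
    using finite_compatible[OF H] by (simp add: E_def)
  have \<mu>_nonneg: "0 \<le> \<mu> p" for p by (simp add: \<mu>_def gibbs_nonneg)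
  \<comment> \<open>The set \<open>U\<close> paired with \<open>p\<close> consists of the sites of \<open>T\<close> where the first sample differs from \<open>r\<close>.\<close>
  have "sum \<mu> P \<le> (\<Sum>(U, p)\<in>Sigma (Pow T) (\<lambda>U. E \<omega>\<^sub>1 U \<times> E \<omega>\<^sub>2 (T - U)). \<mu> p)"
  proof (rule sum_le_included[where i = snd])
    show "finite P" unfolding P_def
      using finite_compatible[OF H] by simp
    show "finite (Sigma (Pow T) (\<lambda>U. E \<omega>\<^sub>1 U \<times> E \<omega>\<^sub>2 (T - U)))" using T finE by blast
    show "\<forall>x\<in>P. \<exists>y\<in>Sigma (Pow T) (\<lambda>U. E \<omega>\<^sub>1 U \<times> E \<omega>\<^sub>2 (T - U)).
        snd y = x \<and> \<mu> x \<le> (case y of (U, p) \<Rightarrow> \<mu> p)"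
    proof
      fix p assume p: "p \<in> P"
      have "({x \<in> T. fst p x \<noteq> r}, p) \<in> Sigma (Pow T) (\<lambda>U. E \<omega>\<^sub>1 U \<times> E \<omega>\<^sub>2 (T - U))"
        using p by (auto simp: P_def E_def disagreement_def)
      then show "\<exists>y\<in>Sigma (Pow T) (\<lambda>U. E \<omega>\<^sub>1 U \<times> E \<omega>\<^sub>2 (T - U)).
        snd y = p \<and> \<mu> p \<le> (case y of (U, p) \<Rightarrow> \<mu> p)" by fastforce
    qed
  qed (auto simp: \<mu>_nonneg)
  also have "\<dots> = (\<Sum>U\<in>Pow T. sum (gibbs H \<Phi> A \<omega>\<^sub>1) (E \<omega>\<^sub>1 U) * sum (gibbs H \<Phi> A \<omega>\<^sub>2) (E \<omega>\<^sub>2 (T - U)))"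
    using T finE unfolding sum_product sum.cartesian_product \<mu>_def
    by (subst sum.Sigma[symmetric]) (auto simp: case_prod_unfold)
  also have "\<dots> \<le> (\<Sum>U\<in>Pow T. q ^ card U * q ^ card (T - U))"
    using \<open>0 \<le> q\<close> rare\<^sub>1 rare\<^sub>2 unfolding E_def
    by (intro sum_mono mult_mono) (auto intro!: sum_nonneg gibbs_nonneg)
  also have "\<dots> = (\<Sum>U\<in>Pow T. q ^ card T)"
  proof (intro sum.cong refl)
    fix U assume "U \<in> Pow T"
    then have "card T = card U + card (T - U)"
      using T by (metis Pow_iff card_Diff_subset card_mono finite_subset le_add_diff_inverse)
    then show "q ^ card U * q ^ card (T - U) = q ^ card T" by (simp add: power_add)
  qed
  also have "\<dots> = (2 * q) ^ card T" using T by (simp add: card_Pow power_mult_distrib)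
  finally show ?thesis unfolding \<mu>_def P_def .
qed

text \<open>
  Union bound over the at most \<open>4 ^ m\<close> self-avoiding walks from each \<open>b \<in> B\<close>, each consisting
  of \<open>m\<close> sites of disagreement and hence of probability at most \<open>(2 * q) ^ m\<close>. The
  balls around \<open>B\<close> lie in \<open>A\<close>, so the walks and their neighbours do, too.
\<close>

lemma marginal_difference_le_power:
  assumes H: "finite (verts H)" "finite A" and "B \<subseteq> A" and \<omega>: "\<omega>\<^sub>1 \<in> Hom H" "\<omega>\<^sub>2 \<in> Hom H"
    and "0 \<le> q"
    and ball: "\<And>b y. b \<in> B \<Longrightarrow> l1 b y \<le> m \<Longrightarrow> y \<in> A"
    and rare: "\<And>\<omega> T. \<omega> \<in> Hom H \<Longrightarrow> T \<subseteq> A \<Longrightarrow> neighbours_within T A \<Longrightarrow>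
      (\<Sum>\<alpha> | \<alpha> \<in> compatible H A \<omega> \<and> (\<forall>x\<in>T. \<alpha> x \<noteq> r). gibbs H \<Phi> A \<omega> \<alpha>) \<le> q ^ card T"
  shows "\<bar>gibbs_marginal H \<Phi> A \<omega>\<^sub>1 B \<beta> - gibbs_marginal H \<Phi> A \<omega>\<^sub>2 B \<beta>\<bar> \<le> real (card B) * (8 * q) ^ m"
proof -
  define X where "X = compatible H A \<omega>\<^sub>1 \<times> compatible H A \<omega>\<^sub>2"
  define \<mu> where "\<mu> p = gibbs H \<Phi> A \<omega>\<^sub>1 (fst p) * gibbs H \<Phi> A \<omega>\<^sub>2 (snd p)" for p
  define D where "D p = disagreement A (fst p) (snd p)" for p :: "(site \<Rightarrow> 'a) \<times> (site \<Rightarrow> 'a)"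
  define W where "W b = {xs \<in> walks b m. distinct xs}" for b
  define I where "I = Sigma (Sigma B W) (\<lambda>(b, xs). {p \<in> X. set xs \<subseteq> D p})"
  have finX: "finite X" unfolding X_def using finite_compatible[OF H] by simp
  have finB: "finite B" using assms finite_subset by blast
  have finW: "finite (W b)" for b by (simp add: W_def finite_walks)
  have \<mu>_nonneg: "0 \<le> \<mu> p" for p by (simp add: \<mu>_def gibbs_nonneg)
  have bound: "(\<Sum>p | p \<in> X \<and> set xs \<subseteq> D p. \<mu> p) \<le> (2 * q) ^ m" if "b \<in> B" "xs \<in> W b" for b xs
  proof -
    have xs: "xs \<in> walks b m" "distinct xs" using that by (auto simp: W_def)
    have near: "y \<in> A" "neighbours_within {y} A" if "y \<in> set xs" for y
    proof -
      have y: "l1 b y < m" using walks_near[OF xs(1) that] .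
      then show "y \<in> A" using ball \<open>b \<in> B\<close> by simp
      have "l1 b z \<le> m" if "adj y z" for z
        using l1_triangle[of b z y] y that adj_iff_l1[of y z] by linarith
      then show "neighbours_within {y} A"
        using ball \<open>b \<in> B\<close> unfolding neighbours_within_def by blast
    qed
    have sub: "U \<subseteq> A" "neighbours_within U A" if "U \<subseteq> set xs" for U
      using near that unfolding neighbours_within_def by blast+
    have "(\<Sum>p | p \<in> X \<and> set xs \<subseteq> D p. \<mu> p) \<le> (2 * q) ^ card (set xs)"
      unfolding X_def D_def \<mu>_def
      by (rule disagreement_set_le[where r = r, OF H _ \<open>0 \<le> q\<close>]) (use rare \<omega> sub in auto)
    then show ?thesis using xs length_walks[OF xs(1)] by (simp add: distinct_card)
  qed
  have "\<bar>gibbs_marginal H \<Phi> A \<omega>\<^sub>1 B \<beta> - gibbs_marginal H \<Phi> A \<omega>\<^sub>2 B \<beta>\<bar> \<le>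
      (\<Sum>p | p \<in> X \<and> \<not> neighbours_within (cluster B (D p)) A. \<mu> p)"
    unfolding X_def \<mu>_def D_def by (rule marginal_difference_le[OF H \<open>B \<subseteq> A\<close> \<omega>])
  also have "\<dots> \<le> (\<Sum>i\<in>I. \<mu> (snd i))"
  proof (rule sum_le_included[where i = snd])
    show "finite {p \<in> X. \<not> neighbours_within (cluster B (D p)) A}" using finX by simp
    show "finite I" unfolding I_def using finX finB finW by (auto intro!: finite_SigmaI)
    show "\<forall>p\<in>{p \<in> X. \<not> neighbours_within (cluster B (D p)) A}. \<exists>i\<in>I. snd i = p \<and> \<mu> p \<le> \<mu> (snd i)"
    proof
      fix p assume p: "p \<in> {p \<in> X. \<not> neighbours_within (cluster B (D p)) A}"
      then obtain b xs where "b \<in> B" "xs \<in> walks b m" "distinct xs" "set xs \<subseteq> D p"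
        using escaping_walk[of B "D p" A m] ball by blast
      with p have "((b, xs), p) \<in> I" by (simp add: I_def W_def)
      then show "\<exists>i\<in>I. snd i = p \<and> \<mu> p \<le> \<mu> (snd i)" by force
    qed
  qed (simp add: \<mu>_nonneg)
  also have "\<dots> = (\<Sum>(b, xs)\<in>Sigma B W. \<Sum>p | p \<in> X \<and> set xs \<subseteq> D p. \<mu> p)"
    unfolding I_def using finX finB finW
    by (subst sum.Sigma[symmetric, where g = "\<lambda>_. \<mu>", unfolded case_prod_unfold])
      (auto simp: case_prod_unfold)
  also have "\<dots> \<le> (\<Sum>(b, xs)\<in>Sigma B W. (2 * q) ^ m)"
    using bound by (intro sum_mono) auto
  also have "\<dots> = real (\<Sum>b\<in>B. card (W b)) * (2 * q) ^ m"
    using finB finW by (simp add: card_SigmaI)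
  also have "\<dots> \<le> real (\<Sum>b\<in>B. 4 ^ m) * (2 * q) ^ m"
  proof (intro mult_right_mono of_nat_mono sum_mono)
    show "card (W b) \<le> 4 ^ m" for b
      unfolding W_def by (rule order.trans[OF card_mono[OF finite_walks] card_walks_le]) auto
  qed (use \<open>0 \<le> q\<close> in simp)
  also have "\<dots> = real (card B) * (4 * (2 * q)) ^ m" by (simp only: power_mult_distrib) simp
  finally show ?thesis by simp
qed

section \<open>The suspension of a path\<close>

text \<open>The short list of non-edges describes the path \<open>0 - 1 - 2 - 3\<close> with loops, joined to the
  non-adjacent pair \<open>4\<close>, \<open>5\<close>.\<close>

definition suspended_path :: "nat cgraph" where
  "suspended_path = \<lparr>verts = {..5},
     edges = {{u, v} |u v. u \<le> 5 \<and> v \<le> 5 \<and> {u, v} \<notin> {{0, 2}, {0, 3}, {1, 3}, {4, 5}}}\<rparr>"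

lemma verts_suspended_path: "verts suspended_path = {..5}"
  by (simp add: suspended_path_def)

lemma edge_iff: "{x, y} \<in> edges suspended_path \<longleftrightarrow>
    x \<le> 5 \<and> y \<le> 5 \<and> {x, y} \<notin> {{0, 2}, {0, 3}, {1, 3}, {4, 5}}"
  unfolding suspended_path_def by (auto simp: doubleton_eq_iff)

lemma constraint_graph_suspended_path: "constraint_graph suspended_path"
  unfolding constraint_graph_def by (auto simp: suspended_path_def)

lemma folds_to_induced:
  assumes "u \<in> W" "v \<in> W" "u \<noteq> v" "W \<subseteq> verts H" "nbhd H u \<inter> W \<subseteq> nbhd H v"
  shows "folds_to (induced H W) (induced H (W - {u}))"
proof -
  have "nbhd (induced H W) w = nbhd H w \<inter> W" if "w \<in> W" for w
    using that assms(4) by (auto simp: nbhd_def induced_def)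
  moreover have "induced (induced H W) (verts (induced H W) - {u}) = induced H (W - {u})"
    by (auto simp: induced_def)
  ultimately show ?thesis
    unfolding folds_to_def using assms
    by (intro bexI[of _ u] bexI[of _ v]) (auto simp: induced_def)
qed

lemma induced_verts:
  assumes "constraint_graph H"
  shows "induced H (verts H) = H"
proof -
  have "{e \<in> edges H. e \<subseteq> verts H} = edges H"
    using assms unfolding constraint_graph_def by blast
  then show ?thesis by (simp add: induced_def)
qed

lemma dismantlable_suspended_path: "dismantlable suspended_path"
proof -
  let ?H = suspended_path
  have "verts ?H = {0, 1, 2, 3, 4, 5}"
    unfolding verts_suspended_path by auto
  then have "?H = induced ?H {0, 1, 2, 3, 4, 5}"
    using induced_verts[OF constraint_graph_suspended_path] by simp
  moreover have "folds_to (induced ?H {0, 1, 2, 3, 4, 5}) (induced ?H ({0, 1, 2, 3, 4, 5} - {0}))"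
    by (rule folds_to_induced[where v = 1])
      (auto simp: verts_suspended_path nbhd_def edge_iff doubleton_eq_iff)
  moreover have "folds_to (induced ?H {1, 2, 3, 4, 5}) (induced ?H ({1, 2, 3, 4, 5} - {3}))"
    by (rule folds_to_induced[where v = 2])
      (auto simp: verts_suspended_path nbhd_def edge_iff doubleton_eq_iff)
  moreover have "folds_to (induced ?H {1, 2, 4, 5}) (induced ?H ({1, 2, 4, 5} - {2}))"
    by (rule folds_to_induced[where v = 1])
      (auto simp: verts_suspended_path nbhd_def edge_iff doubleton_eq_iff)
  moreover have "folds_to (induced ?H {1, 4, 5}) (induced ?H ({1, 4, 5} - {4}))"
    by (rule folds_to_induced[where v = 1])
      (auto simp: verts_suspended_path nbhd_def edge_iff doubleton_eq_iff)
  moreover have "folds_to (induced ?H {1, 5}) (induced ?H ({1, 5} - {5}))"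
    by (rule folds_to_induced[where v = 1])
      (auto simp: verts_suspended_path nbhd_def edge_iff doubleton_eq_iff)
  moreover have "{0, 1, 2, 3, 4, 5} - {0} = {1, 2, 3, 4, 5 :: nat}"
    "{1, 2, 3, 4, 5} - {3} = {1, 2, 4, 5 :: nat}" "{1, 2, 4, 5} - {2} = {1, 4, 5 :: nat}"
    "{1, 4, 5} - {4} = {1, 5 :: nat}" "{1, 5} - {5} = {1 :: nat}" by auto
  ultimately have "folds_to\<^sup>*\<^sup>* ?H (induced ?H {1})"
    by (metis (no_types, lifting) converse_rtranclp_into_rtranclp rtranclp.rtrancl_refl)
  then show ?thesis
    unfolding dismantlable_def by (intro exI[of _ "induced ?H {1}"] exI[of _ 1]) (simp add: induced_def)
qed

section \<open>Frozen corridors\<close>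

text \<open>
  The two points \<open>stripe 4\<close> and \<open>stripe 5\<close> have the same walls but different corridors.
\<close>

definition stripe :: "nat \<Rightarrow> site \<Rightarrow> nat" where
  "stripe c x = (if snd x > 0 then 0 else if snd x < 0 then 3 else c)"

lemma stripe_Hom: "c \<in> {4, 5} \<Longrightarrow> stripe c \<in> Hom suspended_path"
  by (rule HomI) (auto simp: stripe_def verts_suspended_path edge_iff doubleton_eq_iff adj_def)

text \<open>
  Every cell is a common neighbour of \<open>0\<close> and \<open>3\<close>, thus \<open>4\<close> or \<open>5\<close>, and \<open>4\<close> and \<open>5\<close> are not
  adjacent.
\<close>

lemma corridor_constant:
  assumes "\<eta> \<in> Hom suspended_path"
    and "\<And>i. i \<le> n \<Longrightarrow> \<eta> (a + int i, 1) = 0" "\<And>i. i \<le> n \<Longrightarrow> \<eta> (a + int i, -1) = 3"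
    and "i \<le> n"
  shows "\<eta> (a + int i, 0) = \<eta> (a, 0)"
  using assms(4)
proof (induction i)
  case (Suc i)
  have cell: "\<eta> (a + int j, 0) \<in> {4, 5}" if "j \<le> n" for j
  proof -
    have "{\<eta> (a + int j, 0), 0} \<in> edges suspended_path" "{\<eta> (a + int j, 0), 3} \<in> edges suspended_path"
      using Hom_edge[OF assms(1), of "(a + int j, 0)" "(a + int j, 1)"]
        Hom_edge[OF assms(1), of "(a + int j, 0)" "(a + int j, -1)"] assms(2,3)[OF that]
      by (simp_all add: adj_def)
    then have "\<eta> (a + int j, 0) \<le> 5" "\<eta> (a + int j, 0) \<notin> {0, 1, 2, 3}"
      by (auto simp: edge_iff doubleton_eq_iff)
    then show ?thesis by auto
  qed
  have "{\<eta> (a + int i, 0), \<eta> (a + int (Suc i), 0)} \<in> edges suspended_path"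
    using assms(1) by (rule Hom_edge) (simp add: adj_def)
  moreover have "u = v" if "{u, v} \<in> edges suspended_path" "u \<in> {4, 5}" "v \<in> {4, 5}" for u v
    using that by (auto simp: edge_iff)
  ultimately have "\<eta> (a + int i, 0) = \<eta> (a + int (Suc i), 0)"
    using cell[of i] cell[of "Suc i"] Suc.prems by simp
  then show ?case using Suc by simp
qed simp

text \<open>
  Both ends of a corridor can be filled separately, with \<open>4\<close> on the left and \<open>5\<close> on the right,
  but not together; the length of the corridor is arbitrary.
\<close>

lemma not_TSSM_suspended_path: "\<not> TSSM suspended_path"
proof
  assume "TSSM suspended_path"
  then obtain g where g: "\<And>A B S \<alpha> \<beta> \<sigma>.
     \<alpha> \<in> A \<rightarrow>\<^sub>E verts suspended_path \<Longrightarrow> \<beta> \<in> B \<rightarrow>\<^sub>E verts suspended_path \<Longrightarrow> \<sigma> \<in> S \<rightarrow>\<^sub>E verts suspended_path \<Longrightarrow>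
     finite A \<Longrightarrow> finite B \<Longrightarrow> finite S \<Longrightarrow>
     A \<inter> B = {} \<Longrightarrow> A \<inter> S = {} \<Longrightarrow> B \<inter> S = {} \<Longrightarrow> set_dist A B \<ge> enat g \<Longrightarrow>
     globally_admissible suspended_path (A \<union> S) (merge A S (\<alpha>, \<sigma>)) \<Longrightarrow>
     globally_admissible suspended_path (S \<union> B) (merge S B (\<sigma>, \<beta>)) \<Longrightarrow>
     globally_admissible suspended_path (A \<union> S \<union> B) (merge (A \<union> S) B (merge A S (\<alpha>, \<sigma>), \<beta>))"
    unfolding TSSM_def by metis
  define n where "n = Suc g"
  define A B S :: "site set" where "A = {(0, 0)}" and "B = {(int n, 0)}" and
    "S = (\<lambda>i. (int i, 1)) ` {..n} \<union> (\<lambda>i. (int i, -1)) ` {..n}"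
  let ?\<alpha> = "restrict (stripe 4) A" and ?\<beta> = "restrict (stripe 5) B" and ?\<sigma> = "restrict (stripe 4) S"
  have S: "stripe 4 x = stripe 5 x" if "x \<in> S" for x
    using that by (auto simp: S_def stripe_def)
  have verts: "stripe 4 x \<in> verts suspended_path" "stripe 5 x \<in> verts suspended_path" for x
    using Hom_vert stripe_Hom by blast+
  have disj: "A \<inter> B = {}" "A \<inter> S = {}" "B \<inter> S = {}"
    by (auto simp: A_def B_def S_def n_def)
  have "enat g \<le> set_dist A B" by (simp add: set_dist_ge_iff A_def B_def l1_def n_def)
  moreover have "merge A S (?\<alpha>, ?\<sigma>) = restrict (stripe 4) (A \<union> S)"
    by (auto simp: merge_def)
  then have "globally_admissible suspended_path (A \<union> S) (merge A S (?\<alpha>, ?\<sigma>))"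
    unfolding globally_admissible_def using stripe_Hom by blast
  moreover have "merge S B (?\<sigma>, ?\<beta>) = restrict (stripe 5) (S \<union> B)"
    using S by (auto simp: merge_def)
  then have "globally_admissible suspended_path (S \<union> B) (merge S B (?\<sigma>, ?\<beta>))"
    unfolding globally_admissible_def using stripe_Hom by blast
  ultimately have "globally_admissible suspended_path (A \<union> S \<union> B)
      (merge (A \<union> S) B (merge A S (?\<alpha>, ?\<sigma>), ?\<beta>))"
    using verts disj by (intro g) (auto simp: A_def B_def S_def)
  then obtain \<omega> where \<omega>: "\<omega> \<in> Hom suspended_path"
    and eq: "merge (A \<union> S) B (merge A S (?\<alpha>, ?\<sigma>), ?\<beta>) = restrict \<omega> (A \<union> S \<union> B)"
    unfolding globally_admissible_def by blast
  have on_A: "\<omega> x = stripe 4 x" if "x \<in> A" for x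
    using fun_cong[OF eq, of x] that by (simp add: merge_def)
  have on_S: "\<omega> x = stripe 4 x" if "x \<in> S" for x
    using fun_cong[OF eq, of x] that disj by (auto simp: merge_def split: if_splits)
  have on_B: "\<omega> x = stripe 5 x" if "x \<in> B" for x
    using fun_cong[OF eq, of x] that disj by (auto simp: merge_def split: if_splits)
  have "\<omega> (0 + int n, 0) = \<omega> (0, 0)"
  proof (rule corridor_constant[OF \<omega>, of n])
    show "\<omega> (0 + int i, 1) = 0" "\<omega> (0 + int i, - 1) = 3" if "i \<le> n" for i
      using that on_S[of "(int i, 1)"] on_S[of "(int i, -1)"] by (auto simp: S_def stripe_def)
  qed simp
  moreover have "\<omega> (0, 0) = 4" "\<omega> (int n, 0) = 5"
    using on_A[of "(0, 0)"] on_B[of "(int n, 0)"] by (simp_all add: A_def B_def stripe_def)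
  ultimately show False by simp
qed

lemma decay_at_le:
  assumes "decay_function f" "enat n \<le> d"
  shows "decay_at f d \<le> f n"
  using assms by (cases d) (auto simp: decay_function_def decay_at_def decseq_def)

text \<open>
  The two corridors disagree on the boundary of \<open>A\<close> only at the two ends, at distance \<open>n\<close> from
  the middle cell. That cell is \<open>4\<close> with probability one for the first boundary condition and
  with probability zero for the second, and a decay function is eventually below one.
\<close>

lemma not_SSM_suspended_path: "\<not> SSM suspended_path \<Phi>"
proof
  let ?H = suspended_path
  assume "SSM ?H \<Phi>"
  then obtain f where f: "decay_function f" and ssm: "SSM_rate ?H \<Phi> f" by (auto simp: SSM_def)
  have "eventually (\<lambda>n. f n < 1 \<and> n \<ge> 1) sequentially"
    using f by (intro eventually_conj order_tendstoD[of f 0] eventually_ge_at_top)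
      (auto simp: decay_function_def)
  then obtain n where n: "f n < 1" "n \<ge> 1" using eventually_happens by force
  define A B :: "site set" where "A = (\<lambda>i. (i, 0)) ` {- int n<..<int n}" and "B = {(0, 0)}"
  define \<beta> where "\<beta> = restrict (stripe 4) B"
  have fin: "finite A" "finite (verts ?H)" by (auto simp: A_def verts_suspended_path)
  have BA: "B \<subseteq> A" using n by (auto simp: A_def B_def)
  have frozen: "\<alpha> (0, 0) = c" if \<alpha>: "\<alpha> \<in> compatible ?H A (stripe c)" for \<alpha> c
  proof -
    let ?\<eta> = "\<lambda>x. if x \<in> A then \<alpha> x else stripe c x"
    have "?\<eta> \<in> Hom ?H" using \<alpha> by (simp add: compatible_def merge_compl)
    then have "?\<eta> (- int n + int n, 0) = ?\<eta> (- int n, 0)"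
      by (rule corridor_constant[where n = n]) (auto simp: A_def stripe_def)
    then show ?thesis using BA by (auto simp: A_def B_def stripe_def)
  qed
  have "gibbs_marginal ?H \<Phi> A (stripe 4) B \<beta> =
      (\<Sum>\<alpha>\<in>compatible ?H A (stripe 4). gibbs ?H \<Phi> A (stripe 4) \<alpha>)"
    unfolding gibbs_marginal_eq[OF fin(2,1)]
    using frozen[of _ 4] by (intro sum.cong) (auto simp: \<beta>_def B_def stripe_def restrict_def)
  then have "gibbs_marginal ?H \<Phi> A (stripe 4) B \<beta> = 1"
    using fin by (simp add: sum_gibbs stripe_Hom)
  moreover have "gibbs_marginal ?H \<Phi> A (stripe 5) B \<beta> = 0"
  proof -
    have "restrict \<alpha> B \<noteq> \<beta>" if "\<alpha> \<in> compatible ?H A (stripe 5)" for \<alpha>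
    proof
      assume "restrict \<alpha> B = \<beta>"
      then have "restrict \<alpha> B (0, 0) = \<beta> (0, 0)" by simp
      then show False using frozen[OF that] by (simp add: \<beta>_def B_def stripe_def)
    qed
    then have "{\<alpha> \<in> compatible ?H A (stripe 5). restrict \<alpha> B = \<beta>} = {}" by blast
    then show ?thesis unfolding gibbs_marginal_eq[OF fin(2,1)] by (simp only: sum.empty)
  qed
  moreover have "\<beta> \<in> B \<rightarrow>\<^sub>E verts ?H" by (auto simp: \<beta>_def B_def stripe_def verts_suspended_path)
  ultimately have "1 \<le> decay_at f (set_dist B (disagreement (boundary A) (stripe 4) (stripe 5)))"
    using ssm[unfolded SSM_rate_def, rule_format, OF fin(1) BA _ stripe_Hom[of 4] stripe_Hom[of 5], of \<beta>]
    by (simp add: B_def)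
  also have "\<dots> \<le> f n"
  proof (rule decay_at_le[OF f])
    have "n \<le> l1 (0, 0) y" if "y \<in> disagreement (boundary A) (stripe 4) (stripe 5)" for y
    proof -
      have "snd y = 0" "y \<notin> A"
        using that boundary_disjoint by (auto simp: disagreement_def stripe_def split: if_splits)
      then have "fst y \<notin> {- int n<..<int n}" unfolding A_def by (metis imageI prod.collapse)
      then show ?thesis by (auto simp: l1_def)
    qed
    then show "enat n \<le> set_dist B (disagreement (boundary A) (stripe 4) (stripe 5))"
      by (simp add: set_dist_ge_iff B_def del: split_paired_All)
  qed
  finally show False using n by simp
qed

section \<open>Weak spatial mixing from a reward on the central vertex\<close>

text \<open>The Gibbs measures weight a configuration by the exponential of minus the energy, so each site
  with value \<open>1\<close> contributes a factor \<open>L\<close>.\<close>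

definition reward :: "real \<Rightarrow> nat interaction" where
  "reward L z = (case z of Inl v \<Rightarrow> if v = 1 then - ln L else 0 | Inr e \<Rightarrow> 0)"

lemma exp_energy_reward:
  assumes "finite A" "0 < L"
  shows "exp (- energy (reward L) A \<omega> \<alpha>) = L ^ card {x \<in> A. \<alpha> x = 1}"
proof -
  have "- energy (reward L) A \<omega> \<alpha> = (\<Sum>x\<in>A. if \<alpha> x = 1 then ln L else 0)"
    unfolding energy_def reward_def by (simp flip: sum_negf) (simp add: if_distrib cong: if_cong)
  also have "\<dots> = real (card {x \<in> A. \<alpha> x = 1}) * ln L"
    using assms(1) by (simp flip: sum.inter_filter)
  finally show ?thesis using assms by (simp add: exp_of_nat_mult)
qed

definition repair :: "site set \<Rightarrow> (site \<Rightarrow> nat) \<Rightarrow> site \<Rightarrow> nat" where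
  "repair T \<alpha> x = (if x \<in> T then 1 else if \<alpha> x = 3 \<and> (\<exists>t\<in>T. adj t x) then 2 else \<alpha> x)"

lemma edge_1: "x \<le> 5 \<Longrightarrow> x \<noteq> 3 \<Longrightarrow> {1, x} \<in> edges suspended_path"
  by (auto simp: edge_iff doubleton_eq_iff)

lemma edge_2: "{3, x} \<in> edges suspended_path \<Longrightarrow> {2, x} \<in> edges suspended_path"
  by (auto simp: edge_iff doubleton_eq_iff)

lemma edge_replace_3:
  assumes "{a, b} \<in> edges suspended_path" "a' = a \<or> a = 3 \<and> a' = 2" "b' = b \<or> b = 3 \<and> b' = 2"
  shows "{a', b'} \<in> edges suspended_path"
proof -
  have "{a', b} \<in> edges suspended_path" using assms(1,2) edge_2 by blast
  then show ?thesis using assms(3) edge_2[of a'] by (auto simp: insert_commute)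
qed

text \<open>
  The repaired sites are safe next to \<open>T\<close> because \<open>1\<close> is adjacent to everything but \<open>3\<close>, and no
  \<open>3\<close> is left there; elsewhere because \<open>2\<close> is adjacent to all neighbours of \<open>3\<close>. All changes
  take place on \<open>T\<close> and its neighbours, hence inside \<open>A\<close>.
\<close>

lemma repair_compatible:
  assumes \<omega>: "\<omega> \<in> Hom suspended_path" and \<alpha>: "\<alpha> \<in> compatible suspended_path A \<omega>"
    and T: "T \<subseteq> A" "neighbours_within T A"
  shows "repair T \<alpha> \<in> compatible suspended_path A \<omega>"
proof -
  note \<alpha>' = \<alpha>[unfolded compatible_iff[OF \<omega>]]
  have le: "\<alpha> x \<le> 5" if "x \<in> A" for x using \<alpha>' that by (auto simp: verts_suspended_path)
  have same: "repair T \<alpha> x = \<alpha> x \<or> \<alpha> x = 3 \<and> repair T \<alpha> x = 2" if "x \<notin> T" for x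
    using that by (simp add: repair_def)
  have at_T: "{repair T \<alpha> x, repair T \<alpha> y} \<in> edges suspended_path"
    if "x \<in> T" "y \<in> A" "adj x y" for x y
  proof -
    have "repair T \<alpha> y \<noteq> 3" "repair T \<alpha> y \<le> 5" using that le[of y] by (auto simp: repair_def)
    then show ?thesis using edge_1 that by (simp add: repair_def)
  qed
  have "repair T \<alpha> \<in> A \<rightarrow>\<^sub>E verts suspended_path"
    using \<alpha>' T unfolding neighbours_within_def
    by (auto simp: repair_def PiE_iff extensional_def verts_suspended_path)
  moreover have "{repair T \<alpha> x, repair T \<alpha> y} \<in> edges suspended_path"
    if "x \<in> A" "y \<in> A" "adj x y" for x y
  proof (cases "x \<in> T \<or> y \<in> T")
    case True
    then show ?thesis using at_T[of x y] at_T[of y x] that adj_sym[of x y] by (auto simp: insert_commute)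
  next
    case False
    moreover have "{\<alpha> x, \<alpha> y} \<in> edges suspended_path" using \<alpha>' that by blast
    ultimately show ?thesis using edge_replace_3 same by blast
  qed
  moreover have "{repair T \<alpha> x, \<omega> y} \<in> edges suspended_path" if "x \<in> A" "y \<in> - A" "adj x y" for x y
  proof -
    have "x \<notin> T" using T that unfolding neighbours_within_def by blast
    moreover have "{\<alpha> x, \<omega> y} \<in> edges suspended_path" using \<alpha>' that by blast
    ultimately show ?thesis using edge_replace_3 same by blast
  qed
  ultimately show ?thesis by (simp add: compatible_iff[OF \<omega>])
qed

text \<open>
  A Peierls argument. Repairing multiplies the weight by \<open>L ^ card T\<close>; a configuration is
  determined by its repair together with its values on \<open>N\<close>, the set \<open>T\<close> with its neighbours, which
  has at most \<open>5 * card T\<close> sites with six possible values each.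
\<close>

lemma non_1_rare:
  assumes \<omega>: "\<omega> \<in> Hom suspended_path" and A: "finite A" and L: "0 < L"
    and T: "T \<subseteq> A" "neighbours_within T A"
  shows "(\<Sum>\<alpha> | \<alpha> \<in> compatible suspended_path A \<omega> \<and> (\<forall>x\<in>T. \<alpha> x \<noteq> 1).
      gibbs suspended_path (reward L) A \<omega> \<alpha>) \<le> (6 ^ 5 / L) ^ card T"
proof -
  define K where "K = compatible suspended_path A \<omega>"
  define E where "E = {\<alpha> \<in> K. \<forall>x\<in>T. \<alpha> x \<noteq> 1}"
  define w where "w \<alpha> = exp (- energy (reward L) A \<omega> \<alpha>)" for \<alpha>
  define N where "N = T \<union> (\<Union>t\<in>T. {y. adj t y})"
  define F where "F = N \<rightarrow>\<^sub>E {..5::nat}"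
  define g where "g \<alpha> = (repair T \<alpha>, restrict \<alpha> N)" for \<alpha>
  have finH: "finite (verts suspended_path)" by (simp add: verts_suspended_path)
  have finK: "finite K" unfolding K_def by (rule finite_compatible[OF finH A])
  have finT: "finite T" using T A finite_subset by blast
  then have finN: "finite N" by (simp add: N_def finite_neighbours)
  then have finF: "finite F" by (simp add: F_def finite_PiE)
  have Z: "0 < sum w K" unfolding w_def K_def by (rule partition_function_pos[OF finH A \<omega>])

  have "card N \<le> card T + (\<Sum>t\<in>T. card {y. adj t y})"
    unfolding N_def by (rule order.trans[OF card_Un_le add_left_mono[OF card_UN_le[OF finT]]])
  also have "\<dots> \<le> card T + (\<Sum>t\<in>T. 4)" by (intro add_left_mono sum_mono card_neighbours_le)
  finally have "card N \<le> 5 * card T" by simp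
  then have "6 ^ card N \<le> (6::nat) ^ (5 * card T)" by (intro power_increasing) auto
  moreover have "card F = 6 ^ card N" using finN by (simp add: F_def card_PiE)
  ultimately have "card F \<le> (6 ^ 5) ^ card T" by (simp add: power_mult)
  then have cardF: "real (card F) \<le> (6 ^ 5) ^ card T" by (metis of_nat_le_iff of_nat_numeral of_nat_power)

  have gain: "w (repair T \<alpha>) = L ^ card T * w \<alpha>" if "\<alpha> \<in> E" for \<alpha>
  proof -
    have "{x \<in> A. repair T \<alpha> x = 1} = T \<union> {x \<in> A. \<alpha> x = 1}" using T by (auto simp: repair_def)
    moreover have "T \<inter> {x \<in> A. \<alpha> x = 1} = {}" using that by (auto simp: E_def)
    ultimately show ?thesis
      using A finT L by (simp add: w_def exp_energy_reward card_Un_disjoint power_add)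
  qed
  have inj: "inj_on g E"
  proof (rule inj_onI, rule ext)
    fix \<alpha> \<alpha>' x assume eq: "g \<alpha> = g \<alpha>'"
    show "\<alpha> x = \<alpha>' x"
    proof (cases "x \<in> N")
      case True
      then show ?thesis using eq by (metis g_def prod.inject restrict_apply')
    next
      case False
      then have "repair T \<alpha> x = \<alpha> x" "repair T \<alpha>' x = \<alpha>' x" by (auto simp: repair_def N_def)
      then show ?thesis using eq by (metis g_def prod.inject)
    qed
  qed
  have "g \<alpha> \<in> K \<times> F" if "\<alpha> \<in> E" for \<alpha>
  proof -
    have "\<alpha> \<in> K" using that by (simp add: E_def)
    moreover have "N \<subseteq> A" using T unfolding N_def neighbours_within_def by blast
    ultimately show ?thesis
      using repair_compatible[OF \<omega> _ T, of \<alpha>] compatible_subset[of suspended_path A \<omega>]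
      by (fastforce simp: g_def F_def K_def verts_suspended_path)
  qed
  then have "g ` E \<subseteq> K \<times> F" by blast

  have "L ^ card T * sum w E = (\<Sum>\<alpha>\<in>E. w (fst (g \<alpha>)))"
    by (simp add: sum_distrib_left gain g_def)
  also have "\<dots> = (\<Sum>p\<in>g ` E. w (fst p))" by (simp add: sum.reindex[OF inj])
  also have "\<dots> \<le> (\<Sum>p\<in>K \<times> F. w (fst p))"
    using \<open>g ` E \<subseteq> K \<times> F\<close> finK finF by (intro sum_mono2) (auto simp: w_def)
  also have "\<dots> = real (card F) * sum w K"
    by (simp add: sum.cartesian_product[of "\<lambda>\<alpha> _. w \<alpha>", symmetric, unfolded case_prod_unfold] sum_distrib_left)
  also have "\<dots> \<le> (6 ^ 5) ^ card T * sum w K" using cardF Z by (intro mult_right_mono) auto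
  finally have "sum w E / sum w K \<le> (6 ^ 5 / L) ^ card T"
    using Z L by (simp add: field_simps power_divide)
  moreover have "(\<Sum>\<alpha>\<in>E. gibbs suspended_path (reward L) A \<omega> \<alpha>) = sum w E / sum w K"
    unfolding sum_divide_distrib by (intro sum.cong) (auto simp: gibbs_def E_def K_def w_def)
  ultimately show ?thesis by (simp add: E_def K_def)
qed

lemma reward_interaction: "1 \<le> L \<Longrightarrow> nn_interaction H (reward L)"
  by (auto simp: nn_interaction_def reward_def)

text \<open>
  The reward makes the ratio \<open>8 * (6 ^ 5 / L)\<close> of the walk count equal to \<open>exp (- \<gamma>)\<close>. If \<open>B\<close>
  has distance \<open>n\<close> from the boundary, balls of radius \<open>n - 1\<close> around \<open>B\<close> lie in \<open>A\<close>; the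
  constant factor \<open>exp \<gamma>\<close> makes up for the lost unit.
\<close>

lemma exponential_WSM_suspended_path:
  assumes "0 < \<gamma>"
  shows "exponential_WSM suspended_path (reward (8 * 6 ^ 5 * exp \<gamma>)) \<gamma>"
proof -
  let ?H = suspended_path
  define L where "L = 8 * 6 ^ 5 * exp \<gamma>"
  have L: "0 < L" "8 * (6 ^ 5 / L) = exp (- \<gamma>)" by (simp_all add: L_def exp_minus field_simps)
  have "WSM_rate ?H (reward L) (\<lambda>n. exp \<gamma> * exp (- \<gamma> * real n))"
    unfolding WSM_rate_def
  proof (intro allI impI ballI)
    fix A B :: "site set" and \<beta> \<omega>\<^sub>1 \<omega>\<^sub>2
    assume A: "finite A" and BA: "B \<subseteq> A" and \<omega>: "\<omega>\<^sub>1 \<in> Hom ?H" "\<omega>\<^sub>2 \<in> Hom ?H"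
    let ?d = "set_dist B (boundary A)"
    let ?diff = "\<bar>gibbs_marginal ?H (reward L) A \<omega>\<^sub>1 B \<beta> - gibbs_marginal ?H (reward L) A \<omega>\<^sub>2 B \<beta>\<bar>"
    have diff: "?diff \<le> real (card B) * exp (- \<gamma>) ^ m"
      if "\<And>b y. b \<in> B \<Longrightarrow> l1 b y \<le> m \<Longrightarrow> y \<in> A" for m
      unfolding L(2)[symmetric]
      by (rule marginal_difference_le_power[where r = 1, OF _ A BA \<omega> _ that non_1_rare])
        (use L A in \<open>auto simp: verts_suspended_path\<close>)
    show "?diff \<le> real (card B) * decay_at (\<lambda>n. exp \<gamma> * exp (- \<gamma> * real n)) ?d"
    proof (cases ?d)
      case (enat n)
      have "y \<in> A" if "b \<in> B" "l1 b y \<le> n - 1" for b y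
      proof (cases "b = y")
        case False
        then have "l1 b y < n" using that l1_eq_0_iff[of b y] by linarith
        then show ?thesis using near_imp_inside[OF BA that(1)] enat by simp
      qed (use BA that in auto)
      then have "?diff \<le> real (card B) * exp (- \<gamma>) ^ (n - 1)" by (rule diff)
      moreover have "exp (- \<gamma>) ^ (n - 1) \<le> exp \<gamma> * exp (- \<gamma> * real n)"
      proof -
        have "exp (- \<gamma>) ^ (n - 1) = exp (- \<gamma> * real (n - 1))"
          by (simp add: exp_of_nat_mult[symmetric] mult.commute)
        also have "\<dots> \<le> exp (\<gamma> + - \<gamma> * real n)"
          using assms by (cases n) (auto simp: algebra_simps)
        finally show ?thesis by (simp only: exp_add)
      qed
      ultimately show ?thesis
        by (simp add: enat decay_at_def) (meson mult_left_mono of_nat_0_le_iff order.trans)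
    next
      case infinity
      have "B = {}"
      proof (rule ccontr)
        assume "B \<noteq> {}"
        then obtain b where "b \<in> B" by blast
        then have "y \<in> A" for y using near_imp_inside[OF BA, of b y] infinity by simp
        then have "A = UNIV" by blast
        then show False using A by (simp add: infinite_UNIV_char_0 finite_prod)
      qed
      then show ?thesis using diff[of 0] by simp
    qed
  qed
  then show ?thesis
    unfolding exponential_WSM_def L_def by (intro exI[of _ "exp \<gamma>"]) simp
qed

theorem proposition9p2:
  shows "\<exists>H :: nat cgraph. constraint_graph H \<and> dismantlable H \<and>
    \<not> TSSM H \<and>
    (\<nexists>\<Phi>. nn_interaction H \<Phi> \<and> SSM H \<Phi>) \<and>
    (\<forall>\<gamma>>0. \<exists>\<Phi>. nn_interaction H \<Phi> \<and> exponential_WSM H \<Phi> \<gamma>)"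
proof (intro exI[of _ suspended_path] conjI allI impI)
  show "\<exists>\<Phi>. nn_interaction suspended_path \<Phi> \<and> exponential_WSM suspended_path \<Phi> \<gamma>"
    if "0 < \<gamma>" for \<gamma>
  proof (intro exI conjI)
    have "1 \<le> exp \<gamma>" using that by simp
    then have "1 \<le> 8 * 6 ^ 5 * exp \<gamma>" using mult_mono[of 1 "8 * 6 ^ 5" 1 "exp \<gamma>"] by simp
    then show "nn_interaction suspended_path (reward (8 * 6 ^ 5 * exp \<gamma>))"
      by (rule reward_interaction)
  qed (rule exponential_WSM_suspended_path[OF that])
qed (use constraint_graph_suspended_path dismantlable_suspended_path not_TSSM_suspended_path
    not_SSM_suspended_path in auto)

end
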